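(* Let $p=k_{w_1}+k_{w_2}$ and let $W_1\in\mathbb{R}^{p\times n}$ be a constant (unknown) matrix. Along a given closed-loop trajectory, suppose the state $x:[0,\infty)\to\mathbb{R}^n$ satisfies $$\dot x(t)=W_1^T\Phi(t)+\varepsilon_T(t),$$ where $\Phi:[0,\infty)\to\mathbb{R}^p$ (the regressor $\Phi(t)=\Phi(x(t),u(t))$) and $\varepsilon_T:[0,\infty)\to\mathbb{R}^n$ are piecewise continuous and bounded, $\|\Phi(t)\|\le p_1$, $\|\varepsilon_T(t)\|\le p_2$. Fix scalars $k>0$, $l>0$ and define filtered signals by $$k\dot\Phi_f+\Phi_f=\Phi,\quad k\dot x_f+x_f=x,\quad k\dot\varepsilon_{Tf}+\varepsilon_{Tf}=\varepsilon_T,$$ with $\Phi_f(0)=0$, $x_f(0)=x(0)$, $\varepsilon_{Tf}(0)=0$, and $$\Pi(t)=\int_0^t e^{-l(t-s)}\Phi_f(s)\Phi_f^T(s)\,ds,\qquad K(t)=\int_0^t e^{-l(t-s)}\Phi_f(s)\dot x_f(s)^T\,ds .$$ Fix recorded times $t_1,\dots,t_N$ (with $N\ge p$) and set $\Pi_j=\Pi(t_j)$, $K_j=K(t_j)$. Let $\Gamma_1\in\mathbb{R}^{p\times p}$ be a constant symmetric positive definite matrix, and let the estimate $\hat W_1(t)\in\mathbb{R}^{p\times n}$ evolve according to $$\dot{\hat W}_1=-\Gamma_1\Big(\Pi\hat W_1-K+\sum_{j=1}^N\big(\Pi_j\hat W_1-K_j\big)\Big).$$ Let $\tilde W_1=W_1-\hat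 W_1$ and $P(t)=\Pi(t)+\sum_{j=1}^N\Pi_j$. Assume $\Phi$ is persistently excited and that there exist $T_1>0$ and $\lambda_0>0$ with $\lambda_{\min}(P(t))\ge\lambda_0$ for all $t\ge T_1$. Then, with $V_1=\tfrac12\operatorname{tr}(\tilde W_1^T\Gamma_1^{-1}\tilde W_1)$: (i) if $\varepsilon_T\equiv0$, then $\dot V_1\le-\lambda_0\|\tilde W_1\|^2$ for $t\ge T_1$ and $\tilde W_1(t)\to0$ as $t\to\infty$ (asymptotic stability of $\tilde W_1=0$); (ii) in general, with $y_1(t)=-\int_0^te^{-l(t-\tau)}\Phi_f(\tau)\varepsilon_{Tf}^T(\tau)d\tau$, $y_{1j}=y_1(t_j)$, there is a constant $\nu_1$ with $\|y_1(t)+\sum_{j=1}^Ny_{1j}\|\le\nu_1$ for all $t$, and for $t\ge T_1$, $\dot V_1\le-\lambda_0\|\tilde W_1\|^2+\nu_1\|\tilde W_1\|$; hence $\dot V_1<0$ whenever $\|\tilde W_1\|>\nu_1/\lambda_0$, and $\tilde W_1$ is uniformly ultimately bounded.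
   Context: Norms of matrices are Frobenius norms. Persistent excitation of $\Phi$ means: there exist $\alpha_1,\alpha_2,T_1>0$ such that $\alpha_1I\le\int_t^{t+T_1}\Phi(\tau)\Phi^T(\tau)d\tau\le\alpha_2I$ for all $t>0$. Uniform ultimate boundedness (UUB) of a signal means there is a bound $b$ and for every initial condition a finite time after which the signal's norm stays below $b$. The model arises from a control-affine system $\dot x=f(x)+g(x)u$ with $f(x)=w_1\xi_1(x)+\epsilon_f$, $g(x)=w_2\xi_2(x)+\epsilon_g$, $W_1=[w_1^T;w_2^T]$, $\Phi=[\xi_1^T,u^T\xi_2^T]^T$, $\varepsilon_T=\epsilon_f+\epsilon_gu$. *)

theory Defs
  imports "HOL-Analysis.Analysis"
begin

definition outer :: "real^'p \<Rightarrow> real^'n \<Rightarrow> real^'n^'p" where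
  "outer a b = (\<chi> i j. a $ i * b $ j)"

definition piecewise_continuous :: "(real \<Rightarrow> 'a::real_normed_vector) \<Rightarrow> bool" where
  "piecewise_continuous f \<longleftrightarrow>
     (\<forall>T>0. \<exists>S. finite S \<and>
        (\<forall>t\<in>{0..T} - S. continuous (at t within {0..}) f) \<and>
        (\<forall>s\<in>S. (s > 0 \<longrightarrow> (\<exists>L. (f \<longlongrightarrow> L) (at_left s))) \<and> (\<exists>R. (f \<longlongrightarrow> R) (at_right s))))"

definition loewner_le :: "real^'p^'p \<Rightarrow> real^'p^'p \<Rightarrow> bool" where
  "loewner_le A B \<longleftrightarrow> (\<forall>v. v \<bullet> (A *v v) \<le> v \<bullet> (B *v v))"

definition persistently_exciting :: "(real \<Rightarrow> real^'p) \<Rightarrow> bool" where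
  "persistently_exciting Phi \<longleftrightarrow>
     (\<exists>a1 a2 T1. a1 > 0 \<and> a2 > 0 \<and> T1 > 0 \<and>
        (\<forall>t>0. loewner_le (mat a1) (integral {t..t+T1} (\<lambda>\<tau>. outer (Phi \<tau>) (Phi \<tau>))) \<and>
               loewner_le (integral {t..t+T1} (\<lambda>\<tau>. outer (Phi \<tau>) (Phi \<tau>))) (mat a2)))"

definition pos_def :: "real^'p^'p \<Rightarrow> bool" where
  "pos_def A \<longleftrightarrow> transpose A = A \<and> (\<forall>v. v \<noteq> 0 \<longrightarrow> v \<bullet> (A *v v) > 0)"

definition lambda_min :: "real^'p^'p \<Rightarrow> real" where
  "lambda_min A = Min {c. \<exists>v. v \<noteq> 0 \<and> A *v v = c *\<^sub>R v}"

definition Pi_mat :: "real \<Rightarrow> (real \<Rightarrow> real^'p) \<Rightarrow> real \<Rightarrow> real^'p^'p" where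
  "Pi_mat l Phif t = integral {0..t} (\<lambda>s. exp (- l * (t - s)) *\<^sub>R outer (Phif s) (Phif s))"

definition K_mat :: "real \<Rightarrow> (real \<Rightarrow> real^'p) \<Rightarrow> (real \<Rightarrow> real^'n) \<Rightarrow> real \<Rightarrow> real^'n^'p" where
  "K_mat l Phif xfdot t = integral {0..t} (\<lambda>s. exp (- l * (t - s)) *\<^sub>R outer (Phif s) (xfdot s))"

definition estimator_sol ::
  "real^'p^'p \<Rightarrow> real \<Rightarrow> (real \<Rightarrow> real^'p) \<Rightarrow> (real \<Rightarrow> real^'n) \<Rightarrow> nat \<Rightarrow> (nat \<Rightarrow> real)
     \<Rightarrow> (real \<Rightarrow> real^'n^'p) \<Rightarrow> bool" where
  "estimator_sol Gam l Phif xfdot N tr What \<longleftrightarrow>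
     (\<forall>t\<ge>0. (What has_vector_derivative
        (- (Gam ** (Pi_mat l Phif t ** What t - K_mat l Phif xfdot t
            + (\<Sum>j=1..N. Pi_mat l Phif (tr j) ** What t - K_mat l Phif xfdot (tr j))))))
        (at t within {0..}))"

end

theory Submission
  imports Defs "HOL-Real_Asymp.Real_Asymp"
begin

text \<open>The plant equation passes linearly through the first-order filter, so
  \<open>xf' = W1\<^sup>T Phif + epsTf\<close> and hence \<open>K = Pi W1 - y1\<close>. Along any solution of the update law the
  error \<open>W = W1 - What\<close> then obeys \<open>W' = Gam (Y - P W)\<close> with \<open>P = Pi + \<Sum>Pi\<^sub>j\<close> and
  \<open>Y = y1 + \<Sum>y1\<^sub>j\<close>, so \<open>V1 = \<langle>W, Gam\<^sup>-\<^sup>1 W\<rangle>/2\<close> satisfies \<open>V1' = \<langle>W, Y - P W\<rangle> \<le> -\<lambda>\<^sub>0 |W|\<^sup>2 + |Y| |W|\<close>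
  once \<open>\<lambda>\<^sub>m\<^sub>i\<^sub>n(P) \<ge> \<lambda>\<^sub>0\<close>. The filters keep \<open>Phif\<close> and \<open>epsTf\<close> bounded, whence \<open>|Y| \<le> \<nu>\<close>; since
  \<open>V1\<close> is comparable with \<open>|W|\<^sup>2\<close>, completing the square gives \<open>V1' \<le> -a V1 + \<nu>\<^sup>2/(2\<lambda>\<^sub>0)\<close>, which
  yields exponential convergence when \<open>epsT = 0\<close> and ultimate boundedness in general.\<close>

section \<open>Frobenius inner product of matrices\<close>

lemma bounded_linear_matrix_mult_left: "bounded_linear (\<lambda>A :: real^'q^'n. M ** A)"
  for M :: "real^'n^'p"
  unfolding linear_conv_bounded_linear[symmetric]
  by (rule linearI) (simp_all add: vec_eq_iff matrix_matrix_mult_def sum.distrib algebra_simps sum_distrib_left)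

lemma bounded_linear_matrix_mult_right: "bounded_linear (\<lambda>A :: real^'n^'p. A ** M)"
  for M :: "real^'q^'n"
  unfolding linear_conv_bounded_linear[symmetric]
  by (rule linearI) (simp_all add: vec_eq_iff matrix_matrix_mult_def sum.distrib algebra_simps sum_distrib_left)

lemma bounded_linear_transpose: "bounded_linear (transpose :: real^'n^'p \<Rightarrow> real^'p^'n)"
  unfolding linear_conv_bounded_linear[symmetric]
  by (rule linearI) (simp_all add: vec_eq_iff transpose_def)

lemma trace_transpose_mult: "trace (transpose A ** B) = A \<bullet> B"
  for A B :: "real^'n^'p"
proof -
  have "trace (transpose A ** B) = (\<Sum>i\<in>UNIV. \<Sum>k\<in>UNIV. A$k$i * B$k$i)"
    by (simp add: trace_def matrix_matrix_mult_def transpose_def)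
  also have "\<dots> = (\<Sum>k\<in>UNIV. \<Sum>i\<in>UNIV. A$k$i * B$k$i)"
    by (rule sum.swap)
  also have "\<dots> = A \<bullet> B"
    by (simp add: inner_vec_def)
  finally show ?thesis .
qed

lemma inner_matrix_mult_right: "A \<bullet> (M ** B) = (transpose M ** A) \<bullet> B"
  for A :: "real^'n^'p" and M :: "real^'q^'p" and B :: "real^'n^'q"
proof -
  have "A \<bullet> (M ** B) = (\<Sum>i\<in>UNIV. \<Sum>j\<in>UNIV. \<Sum>k\<in>UNIV. A$i$j * M$i$k * B$k$j)"
    by (simp add: inner_vec_def matrix_matrix_mult_def sum_distrib_left mult.assoc)
  also have "\<dots> = (\<Sum>i\<in>UNIV. \<Sum>k\<in>UNIV. \<Sum>j\<in>UNIV. A$i$j * M$i$k * B$k$j)"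
    by (rule sum.cong[OF refl], rule sum.swap)
  also have "\<dots> = (\<Sum>k\<in>UNIV. \<Sum>i\<in>UNIV. \<Sum>j\<in>UNIV. A$i$j * M$i$k * B$k$j)"
    by (rule sum.swap)
  also have "\<dots> = (\<Sum>k\<in>UNIV. \<Sum>j\<in>UNIV. \<Sum>i\<in>UNIV. A$i$j * M$i$k * B$k$j)"
    by (rule sum.cong[OF refl], rule sum.swap)
  also have "\<dots> = (transpose M ** A) \<bullet> B"
    by (simp add: inner_vec_def matrix_matrix_mult_def transpose_def sum_distrib_right
        sum_distrib_left mult_ac)
  finally show ?thesis .
qed

lemma inner_matrix_mult_columns:
  "A \<bullet> (M ** B) = (\<Sum>j\<in>UNIV. column j A \<bullet> (M *v column j B))"
  for A :: "real^'n^'p" and M :: "real^'q^'p" and B :: "real^'n^'q"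
proof -
  have "A \<bullet> (M ** B) = (\<Sum>i\<in>UNIV. \<Sum>j\<in>UNIV. A$i$j * (\<Sum>k\<in>UNIV. M$i$k * B$k$j))"
    by (simp add: inner_vec_def matrix_matrix_mult_def)
  also have "\<dots> = (\<Sum>j\<in>UNIV. \<Sum>i\<in>UNIV. A$i$j * (\<Sum>k\<in>UNIV. M$i$k * B$k$j))"
    by (rule sum.swap)
  also have "\<dots> = (\<Sum>j\<in>UNIV. column j A \<bullet> (M *v column j B))"
    by (simp add: inner_vec_def matrix_vector_mult_def column_def)
  finally show ?thesis .
qed

lemma norm_matrix_squared_columns: "(norm A)\<^sup>2 = (\<Sum>j\<in>UNIV. (norm (column j A))\<^sup>2)"
  for A :: "real^'n^'p"
  using inner_matrix_mult_columns[of A "mat 1" A] by (simp add: power2_norm_eq_inner)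

lemma matrix_quadratic_form_lower_bound:
  fixes M :: "real^'p^'p" and A :: "real^'n^'p"
  assumes "\<And>v. c * (norm v)\<^sup>2 \<le> v \<bullet> (M *v v)"
  shows "c * (norm A)\<^sup>2 \<le> A \<bullet> (M ** A)"
  unfolding inner_matrix_mult_columns norm_matrix_squared_columns sum_distrib_left
  by (rule sum_mono) (rule assms)

lemma matrix_quadratic_form_upper_bound:
  fixes M :: "real^'p^'p"
  obtains K where "K > 0" "\<And>A :: real^'n^'p. A \<bullet> (M ** A) \<le> K * (norm A)\<^sup>2"
proof -
  obtain K where K: "K > 0" "\<And>A::real^'n^'p. norm (M ** A) \<le> norm A * K"
    using bounded_linear.pos_bounded[OF bounded_linear_matrix_mult_left[of M]] by blast
  have "A \<bullet> (M ** A) \<le> K * (norm A)\<^sup>2" for A :: "real^'n^'p"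
  proof -
    have "A \<bullet> (M ** A) \<le> norm A * norm (M ** A)"
      by (rule norm_cauchy_schwarz)
    also have "\<dots> \<le> norm A * (norm A * K)"
      by (rule mult_left_mono[OF K(2)]) simp
    finally show ?thesis
      by (simp add: power2_eq_square mult_ac)
  qed
  with K(1) show thesis by (rule that)
qed

section \<open>Quadratic forms, smallest eigenvalue and positive definiteness\<close>

lemma inner_matrix_vector_mult_transpose: "x \<bullet> (A *v y) = (transpose A *v x) \<bullet> y"
  for A :: "real^'n^'m"
  by (metis dot_lmul_matrix transpose_matrix_vector)

lemma quadratic_form_min_on_sphere:
  fixes A :: "real^'p^'p"
  obtains u where "norm u = 1" "\<And>v. (u \<bullet> (A *v u)) * (norm v)\<^sup>2 \<le> v \<bullet> (A *v v)"
proof -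
  have "(axis undefined 1 :: real^'p) \<in> sphere 0 1"
    by simp
  then have nonempty: "sphere (0::real^'p) 1 \<noteq> {}"
    by blast
  have "continuous_on (sphere (0::real^'p) 1) (\<lambda>v. v \<bullet> (A *v v))"
    by (intro continuous_intros linear_continuous_on matrix_vector_mul_bounded_linear)
  then obtain u where u: "u \<in> sphere 0 1"
    and min: "\<And>w. w \<in> sphere 0 1 \<Longrightarrow> u \<bullet> (A *v u) \<le> w \<bullet> (A *v w)"
    using continuous_attains_inf[OF compact_sphere nonempty] by blast
  have "(u \<bullet> (A *v u)) * (norm v)\<^sup>2 \<le> v \<bullet> (A *v v)" for v
  proof (cases "v = 0")
    case False
    let ?w = "(1 / norm v) *\<^sub>R v"
    have "u \<bullet> (A *v u) \<le> ?w \<bullet> (A *v ?w)"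
      using False by (intro min) simp
    also have "\<dots> = (v \<bullet> (A *v v)) / (norm v)\<^sup>2"
      by (simp add: matrix_vector_mult_scaleR power2_eq_square)
    finally show ?thesis
      using False by (simp add: pos_le_divide_eq)
  qed simp
  with u show thesis
    using that by simp
qed

lemma nonneg_quadratic_imp_linear_coeff_zero:
  fixes b c :: real
  assumes nonneg: "\<And>t. 0 \<le> 2 * t * b + t\<^sup>2 * c" and "c \<ge> 0"
  shows "b = 0"
proof -
  define t where "t = - b / (c + 1)"
  have c1: "c + 1 > 0" and tc: "t * (c + 1) = - b"
    using \<open>c \<ge> 0\<close> by (simp_all add: t_def)
  have "0 \<le> (2 * t * b + t\<^sup>2 * c) * (c + 1)\<^sup>2"
    using nonneg[of t] by simp
  also have "\<dots> = 2 * b * (t * (c + 1)) * (c + 1) + (t * (c + 1))\<^sup>2 * c"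
    by (simp add: power2_eq_square algebra_simps)
  also have "\<dots> = - (b\<^sup>2 * (c + 2))"
    unfolding tc by (simp add: power2_eq_square algebra_simps)
  finally have "b\<^sup>2 * (c + 2) \<le> 0"
    by simp
  then show ?thesis
    using \<open>c \<ge> 0\<close> by (simp add: mult_le_0_iff)
qed

text \<open>The minimiser of the Rayleigh quotient is an eigenvector: otherwise moving from it in
  the direction of its residual would lower the quadratic form.\<close>

lemma symmetric_min_eigenvalue_exists:
  fixes A :: "real^'p^'p"
  assumes sym: "transpose A = A"
  obtains m u where "u \<noteq> 0" "A *v u = m *\<^sub>R u" "\<And>v. m * (norm v)\<^sup>2 \<le> v \<bullet> (A *v v)"
proof -
  obtain u where u1: "norm u = 1" and min: "\<And>v. (u \<bullet> (A *v u)) * (norm v)\<^sup>2 \<le> v \<bullet> (A *v v)"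
    using quadratic_form_min_on_sphere by blast
  define m where "m = u \<bullet> (A *v u)"
  define q where "q v = A *v v - m *\<^sub>R v" for v
  have q_nonneg: "0 \<le> v \<bullet> q v" for v
    using min[of v] by (simp add: q_def m_def inner_diff_right power2_norm_eq_inner)
  have q_u: "u \<bullet> q u = 0"
    using u1 by (simp add: q_def m_def inner_diff_right dot_square_norm)
  have q_sym: "x \<bullet> q y = q x \<bullet> y" for x y
    by (simp add: q_def inner_diff_right inner_diff_left inner_matrix_vector_mult_transpose[of x A y] sym)
  have q_lin: "q (x + t *\<^sub>R y) = q x + t *\<^sub>R q y" for x y t
    by (simp add: q_def matrix_vector_right_distrib matrix_vector_mult_scaleR algebra_simps)
  have "q u \<bullet> q u = 0"
  proof (rule nonneg_quadratic_imp_linear_coeff_zero)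
    show "0 \<le> 2 * t * (q u \<bullet> q u) + t\<^sup>2 * (q u \<bullet> q (q u))" for t
      using q_nonneg[of "u + t *\<^sub>R q u"] q_u q_sym[of u "q u"]
      by (simp add: q_lin inner_add_left inner_add_right power2_eq_square algebra_simps)
  qed (rule q_nonneg)
  then have "A *v u = m *\<^sub>R u"
    by (simp add: q_def)
  moreover have "u \<noteq> 0"
    using u1 by auto
  ultimately show thesis
    using that min by (simp add: m_def)
qed

lemma symmetric_eigenvalues_finite:
  fixes A :: "real^'p^'p"
  assumes sym: "transpose A = A"
  shows "finite {c. \<exists>v. v \<noteq> 0 \<and> A *v v = c *\<^sub>R v}"
proof -
  define E where "E = {c. \<exists>v. v \<noteq> 0 \<and> A *v v = c *\<^sub>R v}"
  define ev where "ev c = (SOME v. v \<noteq> 0 \<and> A *v v = c *\<^sub>R v)" for c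
  have ev: "ev c \<noteq> 0 \<and> A *v ev c = c *\<^sub>R ev c" if "c \<in> E" for c
    using that unfolding E_def ev_def by (metis (mono_tags, lifting) mem_Collect_eq someI_ex)
  have orth: "ev c1 \<bullet> ev c2 = 0" if "c1 \<in> E" "c2 \<in> E" "c1 \<noteq> c2" for c1 c2
  proof -
    have "c1 * (ev c1 \<bullet> ev c2) = (A *v ev c1) \<bullet> ev c2"
      using ev[OF that(1)] by simp
    also have "\<dots> = ev c1 \<bullet> (A *v ev c2)"
      using inner_matrix_vector_mult_transpose[of "ev c1" A "ev c2"] sym by simp
    also have "\<dots> = c2 * (ev c1 \<bullet> ev c2)"
      using ev[OF that(2)] by simp
    finally show ?thesis
      using that(3) by simp
  qed
  have "inj_on ev E"
    using orth ev by (metis inj_onI inner_eq_zero_iff)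
  moreover have "independent (ev ` E)"
  proof (rule pairwise_orthogonal_independent)
    show "pairwise orthogonal (ev ` E)"
      unfolding pairwise_def orthogonal_def using orth by (metis imageE)
    show "0 \<notin> ev ` E"
      using ev by auto
  qed
  then have "finite (ev ` E)"
    using independent_bound by blast
  ultimately show ?thesis
    unfolding E_def by (blast dest: finite_imageD)
qed

lemma lambda_min_quadratic_form_lower_bound:
  fixes A :: "real^'p^'p"
  assumes sym: "transpose A = A" and "c \<le> lambda_min A"
  shows "c * (norm v)\<^sup>2 \<le> v \<bullet> (A *v v)"
proof -
  obtain m u where "u \<noteq> 0" "A *v u = m *\<^sub>R u" and min: "\<And>v. m * (norm v)\<^sup>2 \<le> v \<bullet> (A *v v)"
    using symmetric_min_eigenvalue_exists[OF sym] by blast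
  then have "m \<in> {c. \<exists>v. v \<noteq> 0 \<and> A *v v = c *\<^sub>R v}"
    by blast
  then have "lambda_min A \<le> m"
    unfolding lambda_min_def by (rule Min_le[OF symmetric_eigenvalues_finite[OF sym]])
  then have "c * (norm v)\<^sup>2 \<le> m * (norm v)\<^sup>2"
    using \<open>c \<le> lambda_min A\<close> by (intro mult_right_mono) auto
  with min[of v] show ?thesis
    by linarith
qed

lemma pos_def_quadratic_form_lower_bound:
  fixes A :: "real^'p^'p"
  assumes "pos_def A"
  obtains m where "m > 0" "\<And>v. m * (norm v)\<^sup>2 \<le> v \<bullet> (A *v v)"
proof -
  obtain u where "norm u = 1" "\<And>v. (u \<bullet> (A *v u)) * (norm v)\<^sup>2 \<le> v \<bullet> (A *v v)"
    using quadratic_form_min_on_sphere by blast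
  moreover have "u \<bullet> (A *v u) > 0"
    using assms \<open>norm u = 1\<close> unfolding pos_def_def by (metis norm_zero zero_neq_one)
  ultimately show thesis
    using that by blast
qed

lemma pos_def_matrix_inv:
  fixes A :: "real^'p^'p"
  assumes pd: "pos_def A"
  shows "A ** matrix_inv A = mat 1" "matrix_inv A ** A = mat 1" "pos_def (matrix_inv A)"
proof -
  have sym: "transpose A = A"
    using pd by (simp add: pos_def_def)
  have "\<forall>v. A *v v = 0 \<longrightarrow> v = 0"
    using pd unfolding pos_def_def by (metis inner_zero_right less_irrefl)
  then have "invertible A"
    using matrix_left_invertible_ker invertible_left_inverse by blast
  then have inv: "A ** matrix_inv A = mat 1 \<and> matrix_inv A ** A = mat 1"
    unfolding invertible_def matrix_inv_def by (rule someI_ex)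
  then show "A ** matrix_inv A = mat 1" "matrix_inv A ** A = mat 1"
    by simp_all
  let ?B = "matrix_inv A"
  have "transpose ?B ** A = mat 1"
    using inv by (metis matrix_transpose_mul sym transpose_mat)
  then have "transpose ?B = ?B"
    by (metis inv matrix_mul_assoc matrix_mul_lid matrix_mul_rid)
  moreover have "v \<bullet> (?B *v v) > 0" if "v \<noteq> 0" for v
  proof -
    have A_Bv: "A *v (?B *v v) = v"
      using inv by (simp add: matrix_vector_mul_assoc)
    then have "?B *v v \<noteq> 0"
      using that by auto
    then have "0 < (?B *v v) \<bullet> (A *v (?B *v v))"
      using pd by (simp add: pos_def_def)
    then show ?thesis
      by (simp add: A_Bv inner_commute)
  qed
  ultimately show "pos_def ?B"
    by (simp add: pos_def_def)
qed

section \<open>First-order low-pass filters\<close>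

text \<open>Integral form of \<open>k f' + f = u\<close> on \<open>[0, \<infinity>)\<close>; it does not require the input \<open>u\<close>
  to be continuous.\<close>

definition low_pass_filtered :: "real \<Rightarrow> (real \<Rightarrow> 'a::real_normed_vector) \<Rightarrow> (real \<Rightarrow> 'a) \<Rightarrow> bool"
  where "low_pass_filtered k u f \<longleftrightarrow>
    (\<forall>t\<ge>0. ((\<lambda>s. (1 / k) *\<^sub>R (u s - f s)) has_integral (f t - f 0)) {0..t})"

lemma has_integral_from_0_continuous_on:
  fixes F g :: "real \<Rightarrow> 'a::banach"
  assumes F: "\<And>t. t \<ge> 0 \<Longrightarrow> (g has_integral (F t - F 0)) {0..t}"
  shows "continuous_on {0..T} F"
proof (cases "T \<ge> 0")
  case True
  have "g integrable_on {0..T}"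
    using F[OF True] by blast
  then have "continuous_on {0..T} (\<lambda>t. F 0 + integral {0..t} g)"
    by (intro continuous_intros indefinite_integral_continuous_1)
  moreover have "F 0 + integral {0..t} g = F t" if "t \<in> {0..T}" for t
    using integral_unique[OF F[of t]] that by simp
  ultimately show ?thesis
    by (rule continuous_on_eq)
qed simp

lemma low_pass_filtered_continuous_on:
  "low_pass_filtered k u f \<Longrightarrow> continuous_on {0..T} f"
  for f :: "real \<Rightarrow> 'a::banach"
  unfolding low_pass_filtered_def by (rule has_integral_from_0_continuous_on) blast

lemma low_pass_filtered_bounded_linear:
  assumes "low_pass_filtered k u f" "bounded_linear L"
  shows "low_pass_filtered k (\<lambda>s. L (u s)) (\<lambda>s. L (f s))"
  unfolding low_pass_filtered_def
proof (intro allI impI)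
  fix t :: real
  assume "t \<ge> 0"
  then have "((\<lambda>s. (1 / k) *\<^sub>R (u s - f s)) has_integral (f t - f 0)) {0..t}"
    using assms(1) by (simp add: low_pass_filtered_def)
  from has_integral_linear[OF this assms(2)]
  have "((\<lambda>s. L ((1 / k) *\<^sub>R (u s - f s))) has_integral L (f t - f 0)) {0..t}"
    by (simp add: o_def)
  then show "((\<lambda>s. (1 / k) *\<^sub>R (L (u s) - L (f s))) has_integral (L (f t) - L (f 0))) {0..t}"
    using \<open>bounded_linear L\<close> by (simp add: linear_simps)
qed

text \<open>The output of a real filter cannot cross an upper bound of its input: after the last
  time \<open>s\<^sub>0\<close> at which \<open>f \<le> B\<close>, the integrand \<open>(u - f) / k\<close> would be negative.\<close>

lemma low_pass_filtered_le:
  fixes u f :: "real \<Rightarrow> real"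
  assumes k: "k > 0" and filt: "low_pass_filtered k u f"
    and f0: "f 0 \<le> B" and u_le: "\<And>s. s \<ge> 0 \<Longrightarrow> u s \<le> B" and t: "t \<ge> 0"
  shows "f t \<le> B"
proof (rule ccontr)
  assume "\<not> f t \<le> B"
  let ?g = "\<lambda>s. (1 / k) *\<^sub>R (u s - f s)"
  have F: "(?g has_integral (f s - f 0)) {0..s}" if "s \<ge> 0" for s
    using filt that by (simp add: low_pass_filtered_def)
  define S where "S = {s \<in> {0..t}. f s \<le> B}"
  have closed: "closed S"
    using continuous_closed_preimage[OF low_pass_filtered_continuous_on[OF filt]
        closed_atLeastAtMost[of 0 t], of "{..B}"]
    by (simp add: S_def vimage_def Int_def conj_commute)
  have "0 \<in> S"
    using f0 t by (simp add: S_def)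
  then have nonempty: "S \<noteq> {}"
    by blast
  have bdd: "bdd_above S"
    unfolding S_def by (rule bdd_aboveI[of _ t]) auto
  define s0 where "s0 = Sup S"
  have "s0 \<in> S"
    unfolding s0_def by (rule closed_contains_Sup[OF nonempty bdd closed])
  then have s0: "0 \<le> s0" "s0 \<le> t" "f s0 \<le> B"
    by (simp_all add: S_def)
  have above: "f s > B" if "s0 < s" "s \<le> t" for s
  proof (rule ccontr)
    assume "\<not> f s > B"
    then have "s \<in> S"
      using that s0 by (simp add: S_def)
    then have "s \<le> s0"
      unfolding s0_def by (rule cSup_upper[OF _ bdd])
    with that show False
      by simp
  qed
  have "?g integrable_on {s0..t}"
    by (rule integrable_subinterval_real[OF has_integral_integrable[OF F[OF t]]]) (simp add: s0)
  then have I: "(?g has_integral integral {s0..t} ?g) {s0..t}"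
    by (rule integrable_integral)
  have "(?g has_integral (f s0 - f 0 + integral {s0..t} ?g)) {0..t}"
    by (rule has_integral_combine[OF s0(1,2) F[OF s0(1)] I])
  then have "f s0 - f 0 + integral {s0..t} ?g = f t - f 0"
    using F[OF t] by (rule has_integral_unique)
  then have "f t - f s0 = integral {s0..t} ?g"
    by simp
  also have "\<dots> \<le> 0"
  proof (rule has_integral_le[OF has_integral_spike_finite[OF _ _ I] has_integral_0])
    show "(if s = s0 then 0 else ?g s) \<le> 0" if "s \<in> {s0..t}" for s
    proof (cases "s = s0")
      case False
      then have "u s - f s \<le> 0"
        using that above[of s] u_le[of s] s0 by simp
      then show ?thesis
        using k by (simp add: divide_nonpos_pos)
    qed simp
  qed (rule finite.insertI[OF finite.emptyI, of s0], simp)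
  finally show False
    using \<open>\<not> f t \<le> B\<close> s0 by simp
qed

lemma low_pass_filtered_norm_bound:
  fixes u f :: "real \<Rightarrow> real^'n"
  assumes k: "k > 0" and filt: "low_pass_filtered k u f" and f0: "f 0 = 0"
    and u_bound: "\<And>s. s \<ge> 0 \<Longrightarrow> norm (u s) \<le> B" and t: "t \<ge> 0"
  shows "norm (f t) \<le> real CARD('n) * B"
proof -
  have B: "B \<ge> 0"
    using u_bound[of 0] norm_ge_zero[of "u 0"] by linarith
  have "\<bar>f t $ i\<bar> \<le> B" for i
  proof -
    have u_i: "\<bar>u s $ i\<bar> \<le> B" if "s \<ge> 0" for s
      using component_le_norm_cart[of "u s" i] u_bound[OF that] by linarith
    have "f t $ i \<le> B"
    proof (rule low_pass_filtered_le[where f = "\<lambda>s. f s $ i" and u = "\<lambda>s. u s $ i", OF k _ _ _ t])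
      show "low_pass_filtered k (\<lambda>s. u s $ i) (\<lambda>s. f s $ i)"
        using filt bounded_linear_vec_nth by (rule low_pass_filtered_bounded_linear)
    qed (use f0 B u_i in \<open>auto simp: abs_le_iff\<close>)
    moreover have "- f t $ i \<le> B"
    proof (rule low_pass_filtered_le[where f = "\<lambda>s. - f s $ i" and u = "\<lambda>s. - u s $ i", OF k _ _ _ t])
      show "low_pass_filtered k (\<lambda>s. - u s $ i) (\<lambda>s. - f s $ i)"
        using filt bounded_linear_minus[OF bounded_linear_vec_nth] by (rule low_pass_filtered_bounded_linear)
    qed (use f0 B u_i in \<open>auto simp: abs_le_iff\<close>)
    ultimately show ?thesis
      by simp
  qed
  then have "(\<Sum>i\<in>UNIV. \<bar>f t $ i\<bar>) \<le> (\<Sum>i\<in>(UNIV :: 'n set). B)"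
    by (intro sum_mono) simp
  with norm_le_l1_cart[of "f t"] show ?thesis
    by simp
qed

lemma low_pass_filtered_regression:
  fixes W :: "real^'n^'p" and u uf :: "real \<Rightarrow> real^'p" and d df x xf xfdot :: "real \<Rightarrow> real^'n"
  assumes k: "k > 0"
    and x_eq: "\<And>t. t \<ge> 0 \<Longrightarrow> ((\<lambda>s. transpose W *v u s + d s) has_integral (x t - x 0)) {0..t}"
    and uf: "low_pass_filtered k u uf" "uf 0 = 0"
    and df: "low_pass_filtered k d df" "df 0 = 0"
    and xf_der: "\<And>t. t \<ge> 0 \<Longrightarrow> (xf has_vector_derivative xfdot t) (at t within {0..})"
    and xf_eq: "\<And>t. t \<ge> 0 \<Longrightarrow> k *\<^sub>R xfdot t + xf t = x t" and xf_0: "xf 0 = x 0"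
    and s: "s \<ge> 0"
  shows "xfdot s = transpose W *v uf s + df s"
proof -
  have xfdot: "xfdot t = (1 / k) *\<^sub>R (x t - xf t)" if "t \<ge> 0" for t
  proof -
    have "k *\<^sub>R xfdot t = x t - xf t"
      using xf_eq[OF that] by (simp add: eq_diff_eq)
    then have "(1 / k) *\<^sub>R (k *\<^sub>R xfdot t) = (1 / k) *\<^sub>R (x t - xf t)"
      by simp
    then show ?thesis
      using k by simp
  qed
  define e where "e t = xfdot t - (transpose W *v uf t + df t)" for t
  have e0: "e 0 = 0"
    using xfdot[of 0] xf_0 uf(2) df(2) by (simp add: e_def)
  have "low_pass_filtered k (\<lambda>_. 0) e"
    unfolding low_pass_filtered_def
  proof (intro allI impI)
    fix t :: real
    assume t: "t \<ge> 0"
    have I1: "((\<lambda>s. transpose W *v u s + d s) has_integral (x t - x 0)) {0..t}"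
      by (rule x_eq[OF t])
    have I2: "(xfdot has_integral (xf t - xf 0)) {0..t}"
      using t by (intro fundamental_theorem_of_calculus has_vector_derivative_within_subset[OF xf_der]) auto
    have "((\<lambda>s. (1 / k) *\<^sub>R (u s - uf s)) has_integral (uf t - uf 0)) {0..t}"
      using uf(1) t by (simp add: low_pass_filtered_def)
    from has_integral_linear[OF this matrix_vector_mul_bounded_linear[of "transpose W"]]
    have I3: "((\<lambda>s. transpose W *v ((1 / k) *\<^sub>R (u s - uf s)))
        has_integral (transpose W *v (uf t - uf 0))) {0..t}"
      by (simp add: o_def)
    have I4: "((\<lambda>s. (1 / k) *\<^sub>R (d s - df s)) has_integral (df t - df 0)) {0..t}"
      using df(1) t by (simp add: low_pass_filtered_def)
    have I: "((\<lambda>s. (1 / k) *\<^sub>R ((transpose W *v u s + d s) - xfdot s)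
          - transpose W *v ((1 / k) *\<^sub>R (u s - uf s)) - (1 / k) *\<^sub>R (d s - df s))
        has_integral ((1 / k) *\<^sub>R ((x t - x 0) - (xf t - xf 0))
          - transpose W *v (uf t - uf 0) - (df t - df 0))) {0..t}"
      by (intro has_integral_diff has_integral_cmul I1 I2 I3 I4)
    have integrand: "(1 / k) *\<^sub>R ((transpose W *v u s + d s) - xfdot s)
        - transpose W *v ((1 / k) *\<^sub>R (u s - uf s)) - (1 / k) *\<^sub>R (d s - df s)
      = (1 / k) *\<^sub>R (0 - e s)" for s
      by (simp add: e_def algebra_simps matrix_vector_mult_scaleR matrix_vector_mult_diff_distrib)
    have "(1 / k) *\<^sub>R ((x t - x 0) - (xf t - xf 0)) - transpose W *v (uf t - uf 0)
        - (df t - df 0) = e t - e 0"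
      using xfdot[OF t] xfdot[of 0] xf_0 uf(2) df(2) by (simp add: e_def algebra_simps)
    with I show "((\<lambda>s. (1 / k) *\<^sub>R (0 - e s)) has_integral (e t - e 0)) {0..t}"
      by (simp only: integrand)
  qed
  then have "norm (e s) \<le> real CARD('n) * 0"
    using k e0 s by (intro low_pass_filtered_norm_bound[where u = "\<lambda>_. 0"]) simp_all
  then show ?thesis
    by (simp add: e_def)
qed

section \<open>Exponentially weighted data matrices\<close>

lemma exp_weighted_integral_norm_bound:
  fixes f :: "real \<Rightarrow> 'a::banach"
  assumes l: "l > 0" and t: "t \<ge> 0" and cont: "continuous_on {0..t} f"
    and bound: "\<And>s. s \<in> {0..t} \<Longrightarrow> norm (f s) \<le> C"
  shows "norm (integral {0..t} (\<lambda>s. exp (- l * (t - s)) *\<^sub>R f s)) \<le> C / l"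
proof -
  have "norm (f 0) \<le> C"
    using t by (intro bound) simp
  then have C: "C \<ge> 0"
    using norm_ge_zero[of "f 0"] by linarith
  have "((\<lambda>s. exp (- l * (t - s)) * C) has_integral
      ((\<lambda>s. C * exp (- l * (t - s)) / l) t - (\<lambda>s. C * exp (- l * (t - s)) / l) 0)) {0..t}"
  proof (rule fundamental_theorem_of_calculus[OF t])
    fix s
    have "((\<lambda>s. C * exp (- l * (t - s)) / l) has_real_derivative exp (- l * (t - s)) * C)
        (at s within {0..t})"
      using l by (auto intro!: derivative_eq_intros simp: field_simps)
    then show "((\<lambda>s. C * exp (- l * (t - s)) / l) has_vector_derivative exp (- l * (t - s)) * C)
        (at s within {0..t})"
      by (simp add: has_real_derivative_iff_has_vector_derivative)
  qed
  then have weight: "((\<lambda>s. exp (- l * (t - s)) * C) has_integral (C / l - C * exp (- l * t) / l)) {0..t}"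
    by simp
  have "norm (integral {0..t} (\<lambda>s. exp (- l * (t - s)) *\<^sub>R f s))
      \<le> integral {0..t} (\<lambda>s. exp (- l * (t - s)) * C)"
  proof (rule integral_norm_bound_integral)
    show "(\<lambda>s. exp (- l * (t - s)) *\<^sub>R f s) integrable_on {0..t}"
      by (intro integrable_continuous_interval continuous_intros cont)
    show "(\<lambda>s. exp (- l * (t - s)) * C) integrable_on {0..t}"
      using weight by blast
    show "norm (exp (- l * (t - s)) *\<^sub>R f s) \<le> exp (- l * (t - s)) * C" if "s \<in> {0..t}" for s
      using bound[OF that] by simp
  qed
  also have "\<dots> = C / l - C * exp (- l * t) / l"
    using weight by (rule integral_unique)
  also have "\<dots> \<le> C / l"
    using C l by simp
  finally show ?thesis .
qed

lemma norm_outer: "norm (outer a b) = norm a * norm b"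
  for a :: "real^'p" and b :: "real^'n"
proof -
  have outer_rows: "outer a b = (\<chi> i. a$i *\<^sub>R b)"
    by (simp add: vec_eq_iff outer_def)
  have "(norm (outer a b))\<^sup>2 = (\<Sum>i\<in>UNIV. (a$i *\<^sub>R b) \<bullet> (a$i *\<^sub>R b))"
    unfolding power2_norm_eq_inner outer_rows by (simp add: inner_vec_def)
  also have "\<dots> = (\<Sum>i\<in>UNIV. a$i * a$i) * (b \<bullet> b)"
    by (simp add: sum_distrib_right mult.assoc)
  also have "\<dots> = (norm a * norm b)\<^sup>2"
    by (simp add: power_mult_distrib power2_norm_eq_inner inner_vec_def)
  finally show ?thesis
    by (simp add: power2_eq_imp_eq)
qed

lemma transpose_outer_self: "transpose (outer a a) = outer a a"
  for a :: "real^'p"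
  by (simp add: vec_eq_iff outer_def transpose_def mult.commute)

lemma outer_transpose_mult_add: "outer a (transpose W *v a + e) = outer a a ** W + outer a e"
  for a :: "real^'p" and W :: "real^'n^'p"
  by (simp add: vec_eq_iff outer_def matrix_matrix_mult_def matrix_vector_mult_def transpose_def
      sum_distrib_left algebra_simps)

lemma continuous_on_outer:
  "continuous_on S f \<Longrightarrow> continuous_on S g \<Longrightarrow> continuous_on S (\<lambda>s. outer (f s) (g s))"
  for f :: "real \<Rightarrow> real^'p" and g :: "real \<Rightarrow> real^'n"
  unfolding outer_def by (intro continuous_intros)

lemma transpose_Pi_mat:
  assumes "continuous_on {0..t} Phif"
  shows "transpose (Pi_mat l Phif t) = Pi_mat l Phif t"
proof -
  have "(\<lambda>s. exp (- l * (t - s)) *\<^sub>R outer (Phif s) (Phif s)) integrable_on {0..t}"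
    by (intro integrable_continuous_interval continuous_intros continuous_on_outer assms)
  from integral_linear[OF this bounded_linear_transpose]
  show ?thesis
    by (simp add: Pi_mat_def o_def transpose_scalar transpose_outer_self)
qed

lemma K_mat_regression:
  fixes W :: "real^'n^'p" and Phif :: "real \<Rightarrow> real^'p" and xfdot ef :: "real \<Rightarrow> real^'n"
  assumes Phif: "continuous_on {0..t} Phif" and ef: "continuous_on {0..t} ef"
    and regression: "\<And>s. s \<in> {0..t} \<Longrightarrow> xfdot s = transpose W *v Phif s + ef s"
  shows "K_mat l Phif xfdot t = Pi_mat l Phif t ** W
    + integral {0..t} (\<lambda>s. exp (- l * (t - s)) *\<^sub>R outer (Phif s) (ef s))"
proof -
  let ?h1 = "\<lambda>s. exp (- l * (t - s)) *\<^sub>R outer (Phif s) (Phif s)"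
  let ?h2 = "\<lambda>s. exp (- l * (t - s)) *\<^sub>R outer (Phif s) (ef s)"
  have int1: "?h1 integrable_on {0..t}" and int2: "?h2 integrable_on {0..t}"
    by (intro integrable_continuous_interval continuous_intros continuous_on_outer Phif ef)+
  have "K_mat l Phif xfdot t = integral {0..t} (\<lambda>s. ?h1 s ** W + ?h2 s)"
    unfolding K_mat_def
    by (rule integral_cong)
      (simp only: regression outer_transpose_mult_add scaleR_add_right scalar_matrix_assoc)
  also have "\<dots> = integral {0..t} (\<lambda>s. ?h1 s ** W) + integral {0..t} ?h2"
    using integrable_linear[OF int1 bounded_linear_matrix_mult_right[of W]] int2
    by (intro integral_add) (simp_all add: o_def)
  also have "integral {0..t} (\<lambda>s. ?h1 s ** W) = integral {0..t} ?h1 ** W"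
    using integral_linear[OF int1 bounded_linear_matrix_mult_right[of W]] by (simp add: o_def)
  finally show ?thesis
    by (simp add: Pi_mat_def)
qed

section \<open>Lyapunov estimates\<close>

lemma trace_quadratic_form: "trace (transpose A ** M ** A) = A \<bullet> (M ** A)"
  for A :: "real^'n^'p" and M :: "real^'p^'p"
  by (simp add: matrix_mul_assoc[symmetric] trace_transpose_mult)

lemma lyapunov_has_real_derivative:
  fixes Wh :: "real \<Rightarrow> real^'n^'p" and W R :: "real^'n^'p" and Gam :: "real^'p^'p"
  assumes Gam: "pos_def Gam"
    and der: "(Wh has_vector_derivative (- (Gam ** R))) (at t within S)"
  shows "((\<lambda>s. (1/2) * trace (transpose (W - Wh s) ** matrix_inv Gam ** (W - Wh s)))
    has_real_derivative ((W - Wh t) \<bullet> R)) (at t within S)"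
proof -
  let ?G = "matrix_inv Gam"
  have bilinear: "bounded_bilinear (\<lambda>A B :: real^'n^'p. A \<bullet> (?G ** B))"
    using bounded_bilinear.comp[OF bounded_bilinear_inner bounded_linear_ident
        bounded_linear_matrix_mult_left[of ?G]]
    by simp
  have dW: "((\<lambda>s. W - Wh s) has_vector_derivative (Gam ** R)) (at t within S)"
    using has_vector_derivative_diff[OF has_vector_derivative_const der] by simp
  have "((\<lambda>s. (W - Wh s) \<bullet> (?G ** (W - Wh s))) has_vector_derivative
      ((W - Wh t) \<bullet> (?G ** (Gam ** R)) + (Gam ** R) \<bullet> (?G ** (W - Wh t)))) (at t within S)"
    using bounded_bilinear.has_vector_derivative[OF bilinear dW dW] by simp
  moreover have "(W - Wh t) \<bullet> (?G ** (Gam ** R)) = (W - Wh t) \<bullet> R"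
    by (simp add: matrix_mul_assoc pos_def_matrix_inv[OF Gam])
  moreover have "(Gam ** R) \<bullet> (?G ** (W - Wh t)) = (W - Wh t) \<bullet> R"
  proof -
    have "(Gam ** R) \<bullet> (?G ** (W - Wh t)) = (transpose Gam ** (?G ** (W - Wh t))) \<bullet> R"
      by (subst inner_commute) (rule inner_matrix_mult_right)
    also have "transpose Gam ** (?G ** (W - Wh t)) = W - Wh t"
      using Gam by (simp add: pos_def_def matrix_mul_assoc pos_def_matrix_inv)
    finally show ?thesis .
  qed
  ultimately have "((\<lambda>s. (W - Wh s) \<bullet> (?G ** (W - Wh s))) has_real_derivative
      (2 * ((W - Wh t) \<bullet> R))) (at t within S)"
    by (simp add: has_real_derivative_iff_has_vector_derivative)
  from DERIV_cmult[OF this, of "1/2"] show ?thesis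
    by (simp add: trace_quadratic_form)
qed

text \<open>Comparison principle for \<open>V' \<le> - a V + c\<close>, via the monotonicity of
  \<open>e\<^sup>a\<^sup>t (V t - c / a)\<close>. The assumption \<open>T\<^sub>1 > 0\<close> makes one-sided derivatives on \<open>[0,\<infinity>)\<close>
  two-sided at every \<open>t \<ge> T\<^sub>1\<close>.\<close>

lemma differential_inequality_exponential_bound:
  fixes V :: "real \<Rightarrow> real"
  assumes a: "a > 0" and T1: "T1 > 0"
    and der: "\<And>t. t \<ge> T1 \<Longrightarrow> \<exists>D. (V has_real_derivative D) (at t within {0..}) \<and> D \<le> - a * V t + c"
    and t: "t \<ge> T1"
  shows "V t \<le> c / a + exp (- a * (t - T1)) * (V T1 - c / a)"
proof -
  define g where "g s = exp (a * s) * (V s - c / a)" for s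
  have "g t \<le> g T1"
  proof (rule DERIV_nonpos_imp_nonincreasing[OF t])
    fix s
    assume s: "T1 \<le> s" "s \<le> t"
    obtain D where D: "(V has_real_derivative D) (at s within {0..})" "D \<le> - a * V s + c"
      using der s by blast
    have "at s within {0..} = at s"
      using s T1 by (intro at_within_interior) simp
    with D(1) have "(g has_real_derivative (a * exp (a * s) * (V s - c / a) + exp (a * s) * D)) (at s)"
      unfolding g_def by (auto intro!: derivative_eq_intros)
    moreover have "a * exp (a * s) * (V s - c / a) + exp (a * s) * D = exp (a * s) * (a * V s - c + D)"
      using a by (simp add: field_simps)
    moreover have "exp (a * s) * (a * V s - c + D) \<le> 0"
      using D(2) by (intro mult_nonneg_nonpos) auto
    ultimately show "\<exists>y. (g has_real_derivative y) (at s) \<and> y \<le> 0"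
      by auto
  qed
  then have "V t - c / a \<le> exp (a * T1) * (V T1 - c / a) / exp (a * t)"
    by (simp add: g_def pos_le_divide_eq mult.commute)
  also have "\<dots> = exp (- a * (t - T1)) * (V T1 - c / a)"
  proof -
    have "exp (- a * (t - T1)) = exp (a * T1) / exp (a * t)"
      by (simp add: exp_diff[symmetric] algebra_simps)
    then show ?thesis
      by simp
  qed
  finally show ?thesis
    by simp
qed

lemma exp_decay_tendsto_zero: "a > 0 \<Longrightarrow> ((\<lambda>t. exp (- a * (t - T)) * M) \<longlongrightarrow> 0) at_top"
  for a T M :: real
  by real_asymp


section \<open>The concurrent learning estimator\<close>

locale concurrent_learning_estimator =
  fixes W1 :: "real^'n^'p" and x :: "real \<Rightarrow> real^'n" and Phi :: "real \<Rightarrow> real^'p"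
    and epsT :: "real \<Rightarrow> real^'n" and p1 p2 k l :: real
    and Phif :: "real \<Rightarrow> real^'p" and xf xfdot epsTf :: "real \<Rightarrow> real^'n"
    and N :: nat and tr :: "nat \<Rightarrow> real" and Gam :: "real^'p^'p" and T1 lambda0 :: real
  assumes x_eq: "\<And>t. t \<ge> 0 \<Longrightarrow>
      ((\<lambda>s. transpose W1 *v Phi s + epsT s) has_integral (x t - x 0)) {0..t}"
    and Phi_bd: "\<And>t. t \<ge> 0 \<Longrightarrow> norm (Phi t) \<le> p1"
    and epsT_bd: "\<And>t. t \<ge> 0 \<Longrightarrow> norm (epsT t) \<le> p2"
    and k_pos: "k > 0" and l_pos: "l > 0"
    and Phif_filter: "low_pass_filtered k Phi Phif" and Phif_0: "Phif 0 = 0"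
    and xf_0: "xf 0 = x 0"
    and xf_der: "\<And>t. t \<ge> 0 \<Longrightarrow> (xf has_vector_derivative xfdot t) (at t within {0..})"
    and xf_eq: "\<And>t. t \<ge> 0 \<Longrightarrow> k *\<^sub>R xfdot t + xf t = x t"
    and epsTf_filter: "low_pass_filtered k epsT epsTf" and epsTf_0: "epsTf 0 = 0"
    and tr_nonneg: "\<And>j. j \<in> {1..N} \<Longrightarrow> tr j \<ge> 0"
    and Gam_pd: "pos_def Gam"
    and T1_pos: "T1 > 0" and lambda0_pos: "lambda0 > 0"
    and P_min: "\<And>t. t \<ge> T1 \<Longrightarrow>
      lambda_min (Pi_mat l Phif t + (\<Sum>j=1..N. Pi_mat l Phif (tr j))) \<ge> lambda0"
begin

text \<open>\<open>noise_term\<close>, \<open>total_noise\<close> and \<open>total_excitation\<close> are the paper's \<open>y\<^sub>1\<close>,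
  \<open>y\<^sub>1 + \<Sum>y\<^sub>1\<^sub>j\<close> and \<open>P\<close>; \<open>lyap Wh\<close> is \<open>V\<^sub>1\<close> along an arbitrary solution \<open>Wh\<close> of the update law.\<close>

definition noise_term :: "real \<Rightarrow> real^'n^'p"
  where "noise_term t = - integral {0..t} (\<lambda>\<tau>. exp (- l * (t - \<tau>)) *\<^sub>R outer (Phif \<tau>) (epsTf \<tau>))"

definition total_noise :: "real \<Rightarrow> real^'n^'p"
  where "total_noise t = noise_term t + (\<Sum>j=1..N. noise_term (tr j))"

definition total_excitation :: "real \<Rightarrow> real^'p^'p"
  where "total_excitation t = Pi_mat l Phif t + (\<Sum>j=1..N. Pi_mat l Phif (tr j))"

definition lyap :: "(real \<Rightarrow> real^'n^'p) \<Rightarrow> real \<Rightarrow> real"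
  where "lyap Wh t = (1/2) * trace (transpose (W1 - Wh t) ** matrix_inv Gam ** (W1 - Wh t))"

lemma filtered_regression: "t \<ge> 0 \<Longrightarrow> xfdot t = transpose W1 *v Phif t + epsTf t"
  by (rule low_pass_filtered_regression[OF k_pos x_eq Phif_filter Phif_0 epsTf_filter epsTf_0
        xf_der xf_eq xf_0])

lemma K_mat_eq: "t \<ge> 0 \<Longrightarrow> K_mat l Phif xfdot t = Pi_mat l Phif t ** W1 - noise_term t"
  using K_mat_regression[OF low_pass_filtered_continuous_on[OF Phif_filter]
      low_pass_filtered_continuous_on[OF epsTf_filter] filtered_regression]
  by (simp add: noise_term_def)

lemma update_law_error_form:
  assumes "t \<ge> 0"
  shows "Pi_mat l Phif t ** Wh - K_mat l Phif xfdot t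
      + (\<Sum>j=1..N. Pi_mat l Phif (tr j) ** Wh - K_mat l Phif xfdot (tr j))
    = total_noise t - total_excitation t ** (W1 - Wh)"
proof -
  have mult_left_diff: "C ** (A - B) = C ** A - C ** B" for C :: "real^'p^'p" and A B :: "real^'n^'p"
    by (rule linear_diff[OF bounded_linear.linear[OF bounded_linear_matrix_mult_left]])
  have mult_right_sum: "(\<Sum>j\<in>J. A j) ** C = (\<Sum>j\<in>J. A j ** C)"
    for C :: "real^'n^'p" and A :: "nat \<Rightarrow> real^'p^'p" and J
    by (rule linear_sum[OF bounded_linear.linear[OF bounded_linear_matrix_mult_right]])
  have mult_right_add: "(A + B) ** C = A ** C + B ** C" for C :: "real^'n^'p" and A B :: "real^'p^'p"
    by (rule linear_add[OF bounded_linear.linear[OF bounded_linear_matrix_mult_right]])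
  have "(\<Sum>j=1..N. Pi_mat l Phif (tr j) ** Wh - K_mat l Phif xfdot (tr j))
      = (\<Sum>j=1..N. noise_term (tr j) - Pi_mat l Phif (tr j) ** (W1 - Wh))"
    by (rule sum.cong[OF refl]) (simp add: K_mat_eq tr_nonneg mult_left_diff)
  then show ?thesis
    using assms
    by (simp add: total_noise_def total_excitation_def K_mat_eq mult_left_diff mult_right_sum mult_right_add
        sum_subtractf sum.distrib algebra_simps)
qed

lemma noise_term_bound:
  obtains C where "C \<ge> 0" "\<And>t. t \<ge> 0 \<Longrightarrow> norm (noise_term t) \<le> C"
proof -
  define C where "C = (real CARD('p) * p1) * (real CARD('n) * p2)"
  have Phif: "norm (Phif s) \<le> real CARD('p) * p1" and epsTf: "norm (epsTf s) \<le> real CARD('n) * p2"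
    if "s \<ge> 0" for s
    using that low_pass_filtered_norm_bound[OF k_pos Phif_filter Phif_0 Phi_bd]
      low_pass_filtered_norm_bound[OF k_pos epsTf_filter epsTf_0 epsT_bd] by blast+
  have "norm (noise_term t) \<le> C / l" if t: "t \<ge> 0" for t
    unfolding noise_term_def norm_minus_cancel
  proof (rule exp_weighted_integral_norm_bound[OF l_pos t])
    show "continuous_on {0..t} (\<lambda>s. outer (Phif s) (epsTf s))"
      by (intro continuous_on_outer low_pass_filtered_continuous_on[OF Phif_filter]
          low_pass_filtered_continuous_on[OF epsTf_filter])
    show "norm (outer (Phif s) (epsTf s)) \<le> C" if "s \<in> {0..t}" for s
      using that Phif[of s] epsTf[of s] norm_ge_zero[of "Phif s"]
      by (simp add: C_def norm_outer mult_mono[OF _ _ order_trans[OF norm_ge_zero Phif[of s]] norm_ge_zero])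
  qed
  moreover have "C / l \<ge> 0"
    using norm_ge_zero order_trans[OF _ Phif[of 0]] order_trans[OF _ epsTf[of 0]] l_pos
    by (simp add: C_def)
  ultimately show thesis
    using that by blast
qed

lemma total_noise_bound:
  obtains \<nu> where "\<nu> \<ge> 0" "\<And>t. t \<ge> 0 \<Longrightarrow> norm (total_noise t) \<le> \<nu>"
proof -
  obtain C where C: "C \<ge> 0" "\<And>t. t \<ge> 0 \<Longrightarrow> norm (noise_term t) \<le> C"
    using noise_term_bound by blast
  have "norm (total_noise t) \<le> (1 + real N) * C" if "t \<ge> 0" for t
  proof -
    have "norm (total_noise t) \<le> norm (noise_term t) + (\<Sum>j=1..N. norm (noise_term (tr j)))"
      unfolding total_noise_def by (intro norm_triangle_le add_mono order_refl norm_sum)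
    also have "\<dots> \<le> C + (\<Sum>j=1..N. C)"
      using that C(2) tr_nonneg by (intro add_mono sum_mono) auto
    finally show ?thesis
      by (simp add: algebra_simps)
  qed
  then show thesis
    using C(1) by (intro that[of "(1 + real N) * C"]) simp_all
qed

lemma total_noise_noise_free:
  assumes "\<forall>t\<ge>0. epsT t = 0" "t \<ge> 0"
  shows "total_noise t = 0"
proof -
  have "epsTf s = 0" if "s \<ge> 0" for s
    using low_pass_filtered_norm_bound[OF k_pos epsTf_filter epsTf_0, of 0 s] assms(1) that by simp
  then have "noise_term s = - integral {0..s} (\<lambda>_. 0)" if "s \<ge> 0" for s
    unfolding noise_term_def using that by (intro arg_cong[where f = uminus] integral_cong) (simp add: outer_def vec_eq_iff)
  then show ?thesis
    using assms(2) tr_nonneg by (simp add: total_noise_def)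
qed

lemma lyap_has_derivative_bound:
  assumes sol: "estimator_sol Gam l Phif xfdot N tr Wh" and t: "t \<ge> T1"
  shows "\<exists>D. (lyap Wh has_real_derivative D) (at t within {0..}) \<and>
    D \<le> - lambda0 * (norm (W1 - Wh t))\<^sup>2 + norm (total_noise t) * norm (W1 - Wh t)"
proof -
  let ?W = "W1 - Wh t" and ?P = "total_excitation t"
  have t0: "t \<ge> 0"
    using t T1_pos by simp
  have "(Wh has_vector_derivative (- (Gam ** (total_noise t - ?P ** ?W)))) (at t within {0..})"
    using sol t0 unfolding estimator_sol_def update_law_error_form[OF t0, symmetric] by blast
  then have "(lyap Wh has_real_derivative (?W \<bullet> (total_noise t - ?P ** ?W))) (at t within {0..})"
    unfolding lyap_def[abs_def] by (rule lyapunov_has_real_derivative[OF Gam_pd])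
  moreover have "transpose ?P = ?P"
    using low_pass_filtered_continuous_on[OF Phif_filter]
    by (simp add: total_excitation_def transpose_Pi_mat
        linear_add[OF bounded_linear.linear[OF bounded_linear_transpose]]
        linear_sum[OF bounded_linear.linear[OF bounded_linear_transpose]])
  then have "lambda0 * (norm ?W)\<^sup>2 \<le> ?W \<bullet> (?P ** ?W)"
    using P_min[OF t] by (intro matrix_quadratic_form_lower_bound lambda_min_quadratic_form_lower_bound)
      (simp_all add: total_excitation_def)
  moreover have "?W \<bullet> total_noise t \<le> norm (total_noise t) * norm ?W"
    using norm_cauchy_schwarz[of ?W "total_noise t"] by (simp add: mult.commute)
  ultimately show ?thesis
    by (force simp: inner_diff_right)
qed

lemma lyap_eq_inner: "lyap Wh t = (1/2) * ((W1 - Wh t) \<bullet> (matrix_inv Gam ** (W1 - Wh t)))"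
  by (simp add: lyap_def trace_quadratic_form)

lemma lyap_lower_bound:
  obtains m where "m > 0" "\<And>Wh t. m * (norm (W1 - Wh t))\<^sup>2 \<le> lyap Wh t"
proof -
  obtain m where m: "m > 0" "\<And>v. m * (norm v)\<^sup>2 \<le> v \<bullet> (matrix_inv Gam *v v)"
    using pos_def_quadratic_form_lower_bound[OF pos_def_matrix_inv(3)[OF Gam_pd]] by blast
  show thesis
  proof (rule that[of "m / 2"])
    show "m / 2 * (norm (W1 - Wh t))\<^sup>2 \<le> lyap Wh t" for Wh t
      using matrix_quadratic_form_lower_bound[OF m(2), of "W1 - Wh t"] by (simp add: lyap_eq_inner)
  qed (use m in simp)
qed

lemma lyap_upper_bound:
  obtains M where "M > 0" "\<And>Wh t. lyap Wh t \<le> M * (norm (W1 - Wh t))\<^sup>2"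
proof -
  obtain K where K: "K > 0" "\<And>A :: real^'n^'p. A \<bullet> (matrix_inv Gam ** A) \<le> K * (norm A)\<^sup>2"
    using matrix_quadratic_form_upper_bound by blast
  show thesis
  proof (rule that[of "K / 2"])
    show "lyap Wh t \<le> K / 2 * (norm (W1 - Wh t))\<^sup>2" for Wh t
      using K(2)[of "W1 - Wh t"] by (simp add: lyap_eq_inner)
  qed (use K in simp)
qed

lemma lyap_decreasing_outside_ball:
  assumes \<nu>: "\<And>t. t \<ge> 0 \<Longrightarrow> norm (total_noise t) \<le> \<nu>"
    and sol: "estimator_sol Gam l Phif xfdot N tr Wh" and t: "t \<ge> T1"
  shows "\<exists>D. (lyap Wh has_real_derivative D) (at t within {0..}) \<and>
    D \<le> - lambda0 * (norm (W1 - Wh t))\<^sup>2 + \<nu> * norm (W1 - Wh t) \<and>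
    (norm (W1 - Wh t) > \<nu> / lambda0 \<longrightarrow> D < 0)"
proof -
  let ?w = "norm (W1 - Wh t)"
  obtain D where D: "(lyap Wh has_real_derivative D) (at t within {0..})"
    "D \<le> - lambda0 * ?w\<^sup>2 + norm (total_noise t) * ?w"
    using lyap_has_derivative_bound[OF sol t] by blast
  have "norm (total_noise t) * ?w \<le> \<nu> * ?w"
    using \<nu>[of t] t T1_pos by (intro mult_right_mono) auto
  with D(2) have D_le: "D \<le> - lambda0 * ?w\<^sup>2 + \<nu> * ?w"
    by linarith
  have "D < 0" if far: "?w > \<nu> / lambda0"
  proof -
    have "\<nu> \<ge> 0"
      using \<nu>[of 0] norm_ge_zero[of "total_noise 0"] by linarith
    with lambda0_pos have "\<nu> / lambda0 \<ge> 0"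
      by simp
    with far have "?w > 0"
      by linarith
    moreover have "\<nu> < lambda0 * ?w"
      using far lambda0_pos by (simp add: pos_divide_less_eq mult.commute)
    ultimately have "\<nu> * ?w < (lambda0 * ?w) * ?w"
      by (rule mult_strict_right_mono[rotated])
    with D_le show "D < 0"
      by (simp add: power2_eq_square)
  qed
  with D(1) D_le show ?thesis
    by blast
qed

text \<open>With \<open>\<nu>\<close> bounding the noise, \<open>-\<lambda>\<^sub>0 w\<^sup>2 + \<nu> w \<le> -(\<lambda>\<^sub>0/2) w\<^sup>2 + \<nu>\<^sup>2/(2\<lambda>\<^sub>0)\<close> turns the
  derivative bound into \<open>V' \<le> - a V + \<nu>\<^sup>2/(2\<lambda>\<^sub>0)\<close> with \<open>a\<close> independent of the solution.\<close>

lemma lyap_exponential_bound: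
  assumes \<nu>: "\<And>t. t \<ge> 0 \<Longrightarrow> norm (total_noise t) \<le> \<nu>"
  obtains a where "a > 0" "\<And>Wh t. estimator_sol Gam l Phif xfdot N tr Wh \<Longrightarrow> t \<ge> T1 \<Longrightarrow>
    lyap Wh t \<le> \<nu>\<^sup>2 / (2 * lambda0) / a + exp (- a * (t - T1)) * (lyap Wh T1 - \<nu>\<^sup>2 / (2 * lambda0) / a)"
proof -
  obtain M where M: "M > 0" "\<And>Wh t. lyap Wh t \<le> M * (norm (W1 - Wh t))\<^sup>2"
    using lyap_upper_bound by blast
  define a where "a = lambda0 / (2 * M)"
  have a: "a > 0"
    using lambda0_pos M(1) by (simp add: a_def)
  have lyap_ineq: "\<exists>D. (lyap Wh has_real_derivative D) (at t within {0..}) \<and>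
      D \<le> - a * lyap Wh t + \<nu>\<^sup>2 / (2 * lambda0)"
    if sol: "estimator_sol Gam l Phif xfdot N tr Wh" and t: "t \<ge> T1" for Wh t
  proof -
    let ?w = "norm (W1 - Wh t)"
    obtain D where D: "(lyap Wh has_real_derivative D) (at t within {0..})"
      "D \<le> - lambda0 * ?w\<^sup>2 + \<nu> * ?w"
      using lyap_decreasing_outside_ball[OF \<nu> sol t] by blast
    have "\<nu> * ?w \<le> lambda0 / 2 * ?w\<^sup>2 + \<nu>\<^sup>2 / (2 * lambda0)"
    proof -
      have "lambda0 / 2 * ?w\<^sup>2 + \<nu>\<^sup>2 / (2 * lambda0) - \<nu> * ?w = (lambda0 * ?w - \<nu>)\<^sup>2 / (2 * lambda0)"
        using lambda0_pos by (simp add: field_simps power2_eq_square)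
      moreover have "(lambda0 * ?w - \<nu>)\<^sup>2 / (2 * lambda0) \<ge> 0"
        using lambda0_pos by simp
      ultimately show ?thesis
        by linarith
    qed
    moreover have "a * lyap Wh t \<le> a * (M * ?w\<^sup>2)"
      by (rule mult_left_mono[OF M(2)]) (use a in simp)
    moreover have "a * (M * ?w\<^sup>2) = lambda0 / 2 * ?w\<^sup>2"
      using M(1) by (simp add: a_def)
    ultimately have "D \<le> - a * lyap Wh t + \<nu>\<^sup>2 / (2 * lambda0)"
      using D(2) by linarith
    with D(1) show ?thesis
      by blast
  qed
  show thesis
  proof (rule that[OF a])
    fix Wh t
    assume sol: "estimator_sol Gam l Phif xfdot N tr Wh" and t: "t \<ge> T1"
    show "lyap Wh t \<le> \<nu>\<^sup>2 / (2 * lambda0) / a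
        + exp (- a * (t - T1)) * (lyap Wh T1 - \<nu>\<^sup>2 / (2 * lambda0) / a)"
      by (rule differential_inequality_exponential_bound[OF a T1_pos lyap_ineq[OF sol] t])
  qed
qed

lemma noise_free_error_tendsto_zero:
  assumes noise_free: "\<forall>t\<ge>0. epsT t = 0" and sol: "estimator_sol Gam l Phif xfdot N tr Wh"
  shows "((\<lambda>t. W1 - Wh t) \<longlongrightarrow> 0) at_top"
proof -
  obtain m where m: "m > 0" "\<And>Wh t. m * (norm (W1 - Wh t))\<^sup>2 \<le> lyap Wh t"
    using lyap_lower_bound by blast
  have "norm (total_noise t) \<le> 0" if "t \<ge> 0" for t
    using total_noise_noise_free[OF noise_free that] by simp
  then obtain a where a: "a > 0"
    "\<And>t. t \<ge> T1 \<Longrightarrow> lyap Wh t \<le> 0 + exp (- a * (t - T1)) * (lyap Wh T1 - 0)"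
    using lyap_exponential_bound[of 0] sol by (metis zero_power2 div_0)
  have lim: "((\<lambda>t. exp (- a * (t - T1)) * (lyap Wh T1 / m)) \<longlongrightarrow> 0) at_top"
    using a(1) by (rule exp_decay_tendsto_zero)
  have below: "eventually (\<lambda>t. (norm (W1 - Wh t))\<^sup>2 \<le> exp (- a * (t - T1)) * (lyap Wh T1 / m)) at_top"
    unfolding eventually_at_top_linorder
  proof (intro exI allI impI)
    fix t
    assume "t \<ge> T1"
    then have "m * (norm (W1 - Wh t))\<^sup>2 \<le> exp (- a * (t - T1)) * lyap Wh T1"
      using m(2)[of Wh t] a(2)[of t] by simp
    then show "(norm (W1 - Wh t))\<^sup>2 \<le> exp (- a * (t - T1)) * (lyap Wh T1 / m)"
      using m(1) by (simp add: field_simps)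
  qed
  have "((\<lambda>t. (norm (W1 - Wh t))\<^sup>2) \<longlongrightarrow> 0) at_top"
    by (rule tendsto_sandwich[OF _ below tendsto_const lim]) simp
  from tendsto_real_sqrt[OF this] show ?thesis
    by (simp add: tendsto_norm_zero_iff)
qed

lemma error_uniformly_ultimately_bounded:
  assumes \<nu>: "\<And>t. t \<ge> 0 \<Longrightarrow> norm (total_noise t) \<le> \<nu>"
  shows "\<exists>b. \<forall>Wh. estimator_sol Gam l Phif xfdot N tr Wh \<longrightarrow> (\<exists>T. \<forall>t\<ge>T. norm (W1 - Wh t) \<le> b)"
proof -
  obtain m where m: "m > 0" "\<And>Wh t. m * (norm (W1 - Wh t))\<^sup>2 \<le> lyap Wh t"
    using lyap_lower_bound by blast
  define c where "c = \<nu>\<^sup>2 / (2 * lambda0)"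
  obtain a where a: "a > 0" "\<And>Wh t. estimator_sol Gam l Phif xfdot N tr Wh \<Longrightarrow> t \<ge> T1 \<Longrightarrow>
      lyap Wh t \<le> c / a + exp (- a * (t - T1)) * (lyap Wh T1 - c / a)"
    using lyap_exponential_bound[OF \<nu>] unfolding c_def by blast
  have "\<exists>T. \<forall>t\<ge>T. norm (W1 - Wh t) \<le> sqrt ((c / a + 1) / m)"
    if sol: "estimator_sol Gam l Phif xfdot N tr Wh" for Wh
  proof -
    have "((\<lambda>t. exp (- a * (t - T1)) * (lyap Wh T1 - c / a)) \<longlongrightarrow> 0) at_top"
      using a(1) by (rule exp_decay_tendsto_zero)
    then obtain T0 where T0: "\<And>t. t \<ge> T0 \<Longrightarrow> exp (- a * (t - T1)) * (lyap Wh T1 - c / a) < 1"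
      using order_tendstoD(2)[of _ 0 at_top 1] by (force simp: eventually_at_top_linorder)
    have "norm (W1 - Wh t) \<le> sqrt ((c / a + 1) / m)" if "t \<ge> max T0 T1" for t
    proof (rule real_le_rsqrt)
      have "m * (norm (W1 - Wh t))\<^sup>2 \<le> c / a + 1"
        using m(2)[of Wh t] a(2)[OF sol, of t] T0[of t] that by fastforce
      then show "(norm (W1 - Wh t))\<^sup>2 \<le> (c / a + 1) / m"
        using m(1) by (simp add: field_simps)
    qed
    then show ?thesis
      by blast
  qed
  then show ?thesis
    by blast
qed

end

theorem theorem1:
  fixes W1 :: "real^'n^'p"
    and x :: "real \<Rightarrow> real^'n" and Phi :: "real \<Rightarrow> real^'p" and epsT :: "real \<Rightarrow> real^'n"
    and p1 p2 k l :: real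
    and Phif :: "real \<Rightarrow> real^'p" and xf xfdot :: "real \<Rightarrow> real^'n" and epsTf :: "real \<Rightarrow> real^'n"
    and N :: nat and tr :: "nat \<Rightarrow> real"
    and Gam :: "real^'p^'p" and What :: "real \<Rightarrow> real^'n^'p"
    and T1 lambda0 :: real
  assumes x_eq: "\<And>t. t \<ge> 0 \<Longrightarrow>
              ((\<lambda>s. transpose W1 *v Phi s + epsT s) has_integral (x t - x 0)) {0..t}"
    and Phi_pc: "piecewise_continuous Phi" and epsT_pc: "piecewise_continuous epsT"
    and Phi_bd: "\<And>t. t \<ge> 0 \<Longrightarrow> norm (Phi t) \<le> p1"
    and epsT_bd: "\<And>t. t \<ge> 0 \<Longrightarrow> norm (epsT t) \<le> p2"
    and k_pos: "k > 0" and l_pos: "l > 0"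
    and Phif_0: "Phif 0 = 0"
    and Phif_eq: "\<And>t. t \<ge> 0 \<Longrightarrow>
              ((\<lambda>s. (1 / k) *\<^sub>R (Phi s - Phif s)) has_integral (Phif t - Phif 0)) {0..t}"
    and xf_0: "xf 0 = x 0"
    and xf_der: "\<And>t. t \<ge> 0 \<Longrightarrow> (xf has_vector_derivative xfdot t) (at t within {0..})"
    and xf_eq: "\<And>t. t \<ge> 0 \<Longrightarrow> k *\<^sub>R xfdot t + xf t = x t"
    and epsTf_0: "epsTf 0 = 0"
    and epsTf_eq: "\<And>t. t \<ge> 0 \<Longrightarrow>
              ((\<lambda>s. (1 / k) *\<^sub>R (epsT s - epsTf s)) has_integral (epsTf t - epsTf 0)) {0..t}"
    and N_ge: "N \<ge> CARD('p)"
    and tr_nonneg: "\<And>j. j \<in> {1..N} \<Longrightarrow> tr j \<ge> 0"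
    and Gam_pd: "pos_def Gam"
    and What_sol: "estimator_sol Gam l Phif xfdot N tr What"
    and PE: "persistently_exciting Phi"
    and T1_pos: "T1 > 0" and lambda0_pos: "lambda0 > 0"
    and P_min: "\<And>t. t \<ge> T1 \<Longrightarrow>
              lambda_min (Pi_mat l Phif t + (\<Sum>j=1..N. Pi_mat l Phif (tr j))) \<ge> lambda0"
  defines "Wt \<equiv> (\<lambda>t. W1 - What t)"
    and "V1 \<equiv> (\<lambda>t. (1/2) * trace (transpose (W1 - What t) ** matrix_inv Gam ** (W1 - What t)))"
    and "y1 \<equiv> (\<lambda>t. - integral {0..t} (\<lambda>\<tau>. exp (- l * (t - \<tau>)) *\<^sub>R outer (Phif \<tau>) (epsTf \<tau>)))"
  shows
    "((\<forall>t\<ge>0. epsT t = 0) \<longrightarrow>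
        (\<forall>t\<ge>T1. \<exists>D. (V1 has_real_derivative D) (at t within {0..}) \<and>
                     D \<le> - lambda0 * (norm (Wt t))\<^sup>2)
        \<and> (Wt \<longlongrightarrow> 0) at_top)
     \<and> (\<exists>\<nu>1. (\<forall>t\<ge>0. norm (y1 t + (\<Sum>j=1..N. y1 (tr j))) \<le> \<nu>1)
          \<and> (\<forall>t\<ge>T1. \<exists>D. (V1 has_real_derivative D) (at t within {0..}) \<and>
                     D \<le> - lambda0 * (norm (Wt t))\<^sup>2 + \<nu>1 * norm (Wt t) \<and>
                     (norm (Wt t) > \<nu>1 / lambda0 \<longrightarrow> D < 0))
          \<and> (\<exists>b. \<forall>What'. estimator_sol Gam l Phif xfdot N tr What' \<longrightarrow>
                (\<exists>T. \<forall>t\<ge>T. norm (W1 - What' t) \<le> b)))"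
proof -
  interpret concurrent_learning_estimator W1 x Phi epsT p1 p2 k l Phif xf xfdot epsTf N tr Gam T1 lambda0
    by unfold_locales (fact | simp add: low_pass_filtered_def Phif_eq epsTf_eq)+
  have V1_eq: "V1 = lyap What" and y1_eq: "y1 = noise_term"
    by (simp_all add: V1_def lyap_def[abs_def] y1_def noise_term_def[abs_def])
  obtain \<nu> where \<nu>: "\<And>t. t \<ge> 0 \<Longrightarrow> norm (total_noise t) \<le> \<nu>"
    using total_noise_bound by blast
  have noise_free: "(\<forall>t\<ge>T1. \<exists>D. (V1 has_real_derivative D) (at t within {0..}) \<and>
        D \<le> - lambda0 * (norm (Wt t))\<^sup>2) \<and> (Wt \<longlongrightarrow> 0) at_top"
    if "\<forall>t\<ge>0. epsT t = 0"
    using lyap_has_derivative_bound[OF What_sol] total_noise_noise_free[OF that] T1_pos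
      noise_free_error_tendsto_zero[OF that What_sol]
    by (fastforce simp: V1_eq Wt_def)
  have "\<forall>t\<ge>0. norm (y1 t + (\<Sum>j=1..N. y1 (tr j))) \<le> \<nu>"
    using \<nu> by (simp add: y1_eq total_noise_def)
  moreover have "\<forall>t\<ge>T1. \<exists>D. (V1 has_real_derivative D) (at t within {0..}) \<and>
      D \<le> - lambda0 * (norm (Wt t))\<^sup>2 + \<nu> * norm (Wt t) \<and> (norm (Wt t) > \<nu> / lambda0 \<longrightarrow> D < 0)"
    using lyap_decreasing_outside_ball[OF \<nu> What_sol] by (simp add: V1_eq Wt_def)
  ultimately show ?thesis
    using noise_free error_uniformly_ultimately_bounded[OF \<nu>] by blast
qed

end
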